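(* For any $s\in\{1\}\cup[2,\infty]$ there exists a generalized continued fraction \[ \tau_s=\cfrac{a_1}{1+\cfrac{a_2}{1+\cdots}} \] with $a_n\in\{1,2\}$ for all $n\in\mathbb{Z}^+$ and $\mu_I(\tau_s)=s$.
   Context: The value of the generalized continued fraction with partial numerators $a_n$ and all partial denominators equal to $1$ is the limit $\lim_{n\to\infty}A_n/B_n$ of its convergents, where $A_0=0$, $B_0=1$, $A_1=a_1$, $B_1=1$ and $A_{n+2}=A_{n+1}+a_{n+2}A_n$, $B_{n+2}=B_{n+1}+a_{n+2}B_n$ for $n\ge 0$. For a real number $\tau$, an irrationality exponent of $\tau$ is any $\mu$ for which there exist positive constants $c$ and $N_0$ such that $\left|\tau-\frac{M}{N}\right|\ge \frac{c}{N^{\mu}}$ for all $M,N\in\mathbb{Z}$ with $N\ge N_0$ and $\frac{M}{N}\ne\tau$. The asymptotic irrationality exponent $\mu_I(\tau)\in[1,\infty]$ is the infimum of all irrationality exponents $\mu$ of $\tau$, where the infimum of the empty set is $\infty$. With this convention $\mu_I(\tau)=1$ for rational $\tau$. The value $s=\infty$ is allowed in the claim. *)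

theory Defs
  imports "HOL-Analysis.Analysis"
begin

text \<open>
  Numerators and denominators of the convergents of the generalized continued fraction
  with partial numerators \<open>a 1, a 2, \<dots>\<close> and all partial denominators equal to 1;
  the entry \<open>a 0\<close> is never used.
\<close>

fun gcf_num :: "(nat \<Rightarrow> real) \<Rightarrow> nat \<Rightarrow> real" where
  "gcf_num a 0 = 0"
| "gcf_num a (Suc 0) = a 1"
| "gcf_num a (Suc (Suc n)) = gcf_num a (Suc n) + a (n + 2) * gcf_num a n"

fun gcf_den :: "(nat \<Rightarrow> real) \<Rightarrow> nat \<Rightarrow> real" where
  "gcf_den a 0 = 1"
| "gcf_den a (Suc 0) = 1"
| "gcf_den a (Suc (Suc n)) = gcf_den a (Suc n) + a (n + 2) * gcf_den a n"

text \<open>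
  Stated as a relation, so that having a value includes convergence of the convergents.
  The quotient is the intended one whenever the denominators do not vanish, in particular
  for positive partial numerators.
\<close>

definition gcf_has_value :: "(nat \<Rightarrow> real) \<Rightarrow> real \<Rightarrow> bool" where
  "gcf_has_value a \<tau> \<longleftrightarrow> (\<lambda>n. gcf_num a n / gcf_den a n) \<longlonglongrightarrow> \<tau>"

definition irrationality_exponent :: "real \<Rightarrow> real \<Rightarrow> bool" where
  "irrationality_exponent \<tau> \<mu> \<longleftrightarrow>
     (\<exists>c N\<^sub>0 :: real. c > 0 \<and> N\<^sub>0 > 0 \<and>
        (\<forall>M N :: int. real_of_int N \<ge> N\<^sub>0 \<and> real_of_int M / real_of_int N \<noteq> \<tau> \<longrightarrow>
           \<bar>\<tau> - real_of_int M / real_of_int N\<bar> \<ge> c / real_of_int N powr \<mu>))"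

text \<open>The infimum is taken in \<^typ>\<open>ereal\<close>, where the infimum of the empty set is \<open>\<infinity>\<close>.\<close>

definition asymptotic_irrationality_exponent :: "real \<Rightarrow> ereal" ("\<mu>\<^sub>I") where
  "\<mu>\<^sub>I \<tau> = Inf (ereal ` {\<mu>. irrationality_exponent \<tau> \<mu>})"

end

theory Submission
  imports Defs
begin

text \<open>
  For \<open>s = 1\<close> the constant word \<open>2, 2, 2, \<dots>\<close> has the rational value 1. For \<open>s \<ge> 2\<close> the
  number is built from blocks consisting of \<open>2 * m\<close> entries 2, four entries 1 and again
  \<open>2 * m\<close> entries 2, where \<open>m\<close> is chosen anew for each block.

  A long run of 2s pulls the tail of the fraction towards 1, the attracting fixed point of
  \<open>t \<mapsto> 2 / (1 + t)\<close>, so replacing the tail by 1 gives a good rational approximation.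
  On the other hand each 2 doubles the absolute value of \<open>A (n + 1) * B n - A n * B (n + 1)\<close>, which
  spoils later approximations unless the powers of 2 cancel between numerators and denominators.
  In a block as above all of them cancel. To see this, let \<open>x\<close> be the
  sequence of numerators or of denominators and follow
  \<open>X = x (n + 1) + x n\<close> and \<open>Y = 2 * x n - x (n + 1)\<close>. An entry 2 doubles \<open>X\<close> and negates \<open>Y\<close>,
  whereas four entries 1 map \<open>(X, Y)\<close> to \<open>(7 * X - Y, X)\<close>. A block therefore maps
  \<open>(X, Y)\<close> to \<open>4 ^ m * (7 * 4 ^ m * X - Y, X)\<close> (lemma \<open>twos_ones_twos\<close>); the factor
  \<open>4 ^ m\<close> is common to numerators and denominators. After removing it, the approximations
  \<open>P i / R i\<close> obtained at the block boundaries satisfy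
  \<open>R (i + 1) = 7 * 4 ^ m i * R i - R (i - 1)\<close>, likewise for \<open>P\<close>, and the determinant
  \<open>P (i + 1) * R i - P i * R (i + 1)\<close> is always \<open>-3\<close>. Hence \<open>P i - R i * \<tau>\<close> lies between
  \<open>3 / R (i + 1)\<close> and \<open>6 / R (i + 1)\<close> (lemma \<open>block_approximation\<close>).

  This makes the exponent a matter of the growth of \<open>R\<close>. A bounded nonzero determinant lets the
  approximations \<open>P i / R i\<close> control all other fractions (lemma \<open>irrationality_exponentI\<close>), so if
  \<open>R (i + 1)\<close> is comparable to \<open>R i powr (s - 1)\<close>, then the exponent is exactly \<open>s\<close>. As
  \<open>R (i + 1)\<close> is comparable to \<open>4 ^ m i * R i\<close> and \<open>m i\<close> is free, the quotient \<open>R (i + 1) / R i\<close>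
  can be prescribed up to a constant factor: choosing \<open>4 ^ m i\<close> near \<open>R i powr (s - 2)\<close> gives a finite
  exponent \<open>s\<close>, and choosing it at least \<open>R i ^ i\<close> gives a Liouville number.
\<close>

section \<open>Convergence\<close>

lemma gcf_den_ge_1:
  assumes "\<And>n. 0 \<le> a n"
  shows "1 \<le> gcf_den a n"
proof (induction n rule: less_induct)
  case (less n)
  consider "n = 0" | "n = 1" | k where "n = Suc (Suc k)"
    by (metis One_nat_def not0_implies_Suc)
  then show ?case
  proof cases
    case 3
    have "0 \<le> a (k + 2) * gcf_den a k"
      using assms less[of k] 3 by auto
    with less[of "Suc k"] 3 show ?thesis by simp
  qed auto
qed

lemma gcf_den_mono:
  assumes "\<And>n. 0 \<le> a n"
  shows "gcf_den a n \<le> gcf_den a (Suc n)"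
proof (cases n)
  case (Suc k)
  have "0 \<le> a (k + 2) * gcf_den a k"
    using assms gcf_den_ge_1[of a k] by auto
  then show ?thesis using Suc by simp
qed simp

text \<open>
  Consecutive differences of the convergents shrink by the factor
  \<open>a (n + 2) * B n / B (n + 2)\<close>, which is at most \<open>2 / 3\<close> because \<open>B\<close> is increasing.
\<close>
lemma gcf_convergent:
  assumes a: "\<And>n. 0 \<le> a n" "\<And>n. a n \<le> 2"
  shows "convergent (\<lambda>n. gcf_num a n / gcf_den a n)"
proof -
  let ?A = "gcf_num a" and ?B = "gcf_den a"
  let ?z = "\<lambda>n. ?A n / ?B n"
  have B1: "1 \<le> ?B n" for n using gcf_den_ge_1 a by blast
  have B0: "?B n > 0" for n using B1[of n] by linarith
  have Bm: "?B n \<le> ?B (Suc n)" for n using gcf_den_mono a by blast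
  have diff: "?z (Suc n) - ?z n
      = (?A (Suc n) * ?B n - ?A n * ?B (Suc n)) / (?B n * ?B (Suc n))" for n
    using B0[of n] B0[of "Suc n"] by (simp add: field_simps)
  have ratio: "\<bar>?z (Suc (Suc n)) - ?z (Suc n)\<bar> \<le> 2/3 * \<bar>?z (Suc n) - ?z n\<bar>" for n
  proof -
    let ?D = "?A (Suc n) * ?B n - ?A n * ?B (Suc n)"
    have "?A (Suc (Suc n)) * ?B (Suc n) - ?A (Suc n) * ?B (Suc (Suc n)) = - a (n + 2) * ?D"
      by (simp add: algebra_simps)
    then have "?z (Suc (Suc n)) - ?z (Suc n) = - a (n + 2) * ?D / (?B (Suc n) * ?B (Suc (Suc n)))"
      by (simp only: diff)
    also have "\<dots> = - (a (n + 2) * ?B n / ?B (Suc (Suc n))) * (?z (Suc n) - ?z n)"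
      unfolding diff using B0[of n] by (simp del: gcf_num.simps gcf_den.simps)
    finally have "?z (Suc (Suc n)) - ?z (Suc n)
        = - (a (n + 2) * ?B n / ?B (Suc (Suc n))) * (?z (Suc n) - ?z n)" .
    moreover have "a (n + 2) * ?B n / ?B (Suc (Suc n)) \<le> 2/3"
    proof -
      define t where "t = a (n + 2) * ?B n"
      have "t \<le> 2 * ?B (Suc n)"
        unfolding t_def using mult_mono[OF a(2)[of "n + 2"] Bm[of n]] B0[of n] a(1) by simp
      moreover have "?B (Suc (Suc n)) = ?B (Suc n) + t" by (simp add: t_def)
      ultimately have "3 * t \<le> 2 * ?B (Suc (Suc n))" by linarith
      then show ?thesis using B0[of "Suc (Suc n)"]
        unfolding t_def[symmetric] by (simp add: divide_le_eq del: gcf_den.simps)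
    qed
    moreover have "0 \<le> a (n + 2) * ?B n / ?B (Suc (Suc n))"
      using a(1)[of "n + 2"] B0[of n] B0[of "Suc (Suc n)"]
      by (simp del: gcf_den.simps)
    ultimately show ?thesis
      by (simp only: abs_mult abs_minus_cancel abs_of_nonneg) (rule mult_right_mono, auto)
  qed
  have "summable (\<lambda>n. ?z (Suc n) - ?z n)"
    by (rule summable_ratio_test[where c = "2/3" and N = 0]) (use ratio in auto)
  then have "convergent (\<lambda>n. \<Sum>k<n. ?z (Suc k) - ?z k)"
    by (simp add: summable_iff_convergent)
  then have "convergent (\<lambda>n. ?z n - ?z 0)"
    by (simp only: sum_lessThan_telescope[of ?z])
  then have "convergent (\<lambda>n. (?z n - ?z 0) + ?z 0)"
    by (intro convergent_add convergent_const)
  then show ?thesis by simp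
qed

text \<open>
  Replacing the tail of the fraction by 1 turns a convergent into the mediant of two
  consecutive convergents, which lies between them.
\<close>
lemma gcf_mediants_tendsto:
  assumes a: "\<And>n. 0 \<le> a n" and \<tau>: "gcf_has_value a \<tau>"
  shows "(\<lambda>n. (gcf_num a (Suc n) + gcf_num a n) / (gcf_den a (Suc n) + gcf_den a n))
           \<longlonglongrightarrow> \<tau>"
proof -
  let ?A = "gcf_num a" and ?B = "gcf_den a"
  let ?z = "\<lambda>n. ?A n / ?B n" and ?w = "\<lambda>n. ?B (Suc n) / (?B (Suc n) + ?B n)"
  have B0: "?B n > 0" for n using gcf_den_ge_1[of a n] a by force
  have z: "?z \<longlonglongrightarrow> \<tau>" using \<tau> by (simp add: gcf_has_value_def)
  have z': "(\<lambda>n. ?z (Suc n)) \<longlonglongrightarrow> \<tau>" using z by (rule LIMSEQ_Suc)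
  have "(\<lambda>n. ?z (Suc n) - ?z n) \<longlonglongrightarrow> 0"
    using tendsto_diff[OF z' z] by simp
  then have "(\<lambda>n. ?w n * (?z (Suc n) - ?z n)) \<longlonglongrightarrow> 0"
  proof (rule Lim_null_comparison[rotated, OF tendsto_rabs_zero], intro always_eventually allI)
    fix n
    have "\<bar>?w n\<bar> \<le> 1" using B0[of n] B0[of "Suc n"] by simp
    then show "norm (?w n * (?z (Suc n) - ?z n)) \<le> \<bar>?z (Suc n) - ?z n\<bar>"
      unfolding real_norm_def abs_mult by (rule mult_left_le_one_le[OF abs_ge_zero abs_ge_zero])
  qed
  from tendsto_add[OF z this]
  have "(\<lambda>n. ?z n + ?w n * (?z (Suc n) - ?z n)) \<longlonglongrightarrow> \<tau>" by simp
  moreover have "?z n + ?w n * (?z (Suc n) - ?z n) = (?A (Suc n) + ?A n) / (?B (Suc n) + ?B n)" for n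
  proof -
    have "?B (Suc n) + ?B n \<noteq> 0" using B0[of n] B0[of "Suc n"] by linarith
    then show ?thesis using B0[of n] B0[of "Suc n"]
      by (simp add: divide_simps) (simp add: algebra_simps)
  qed
  ultimately show ?thesis by simp
qed

section \<open>Blocks of partial numerators\<close>

text \<open>
  The characteristic polynomial \<open>t\<^sup>2 - t - 2\<close> of the recurrence has the roots 2 and \<open>-1\<close>, and
  the two linear forms are the corresponding eigenforms of one step.
\<close>
lemma run_of_twos:
  fixes x :: "nat \<Rightarrow> real"
  assumes rec: "\<And>n. x (Suc (Suc n)) = x (Suc n) + b n * x n"
    and "\<forall>j<k. b (n + j) = 2"
  shows "x (Suc (n + k)) + x (n + k) = 2 ^ k * (x (Suc n) + x n)"
    and "2 * x (n + k) - x (Suc (n + k)) = (-1) ^ k * (2 * x n - x (Suc n))"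
  using assms(2)
proof (induction k)
  case (Suc k)
  { case 1
    with Suc.IH(1) rec[of "n + k"] show ?case by simp }
  { case 2
    with Suc.IH(2) rec[of "n + k"] show ?case by simp }
qed simp_all

text \<open>
  Four is the only length for which the new value of the form for \<open>-1\<close> contains no multiple of
  the old one; such a multiple would miss the factor \<open>2 ^ k\<close> that a preceding run of 2s gives to
  the form for 2.
\<close>
lemma four_ones:
  fixes x :: "nat \<Rightarrow> real"
  assumes rec: "\<And>n. x (Suc (Suc n)) = x (Suc n) + b n * x n"
    and b: "\<forall>j<4. b (n + j) = 1"
  shows "x (Suc (n + 4)) + x (n + 4) = 7 * (x (Suc n) + x n) - (2 * x n - x (Suc n))"
    and "2 * x (n + 4) - x (Suc (n + 4)) = x (Suc n) + x n"
  using rec[of n] rec[of "n + 1"] rec[of "n + 2"] rec[of "n + 3"]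
    b[rule_format, of 0] b[rule_format, of 1] b[rule_format, of 2] b[rule_format, of 3]
  by (simp_all add: eval_nat_numeral)

text \<open>
  After the first run only \<open>X\<close> carries the factor \<open>4 ^ m\<close>; the four 1s move \<open>X\<close> into the place of
  \<open>Y\<close>, and the second run supplies the factor to the other component. The runs have even
  length so that the eigenvalue \<open>-1\<close> leaves no sign.
\<close>
lemma twos_ones_twos:
  fixes x :: "nat \<Rightarrow> real"
  assumes rec: "\<And>n. x (Suc (Suc n)) = x (Suc n) + b n * x n"
    and twos: "\<forall>j<2 * m. b (n + j) = 2"
      "\<forall>j<2 * m. b (n + 2 * m + 4 + j) = 2"
    and ones: "\<forall>j<4. b (n + 2 * m + j) = 1"
  shows "x (Suc (n + (4 * m + 4))) + x (n + (4 * m + 4))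
           = 4 ^ m * (7 * 4 ^ m * (x (Suc n) + x n) - (2 * x n - x (Suc n)))"
    and "2 * x (n + (4 * m + 4)) - x (Suc (n + (4 * m + 4))) = 4 ^ m * (x (Suc n) + x n)"
proof -
  have e: "n + (4 * m + 4) = n + 2 * m + 4 + 2 * m" by simp
  have p: "(2::real) ^ (2 * m) = 4 ^ m" by (simp add: power_mult)
  note r1 = run_of_twos[of x b "2 * m" n, OF rec twos(1)]
  note o = four_ones[of x b "n + 2 * m", OF rec ones]
  note r2 = run_of_twos[of x b "2 * m" "n + 2 * m + 4", OF rec twos(2)]
  show "x (Suc (n + (4 * m + 4))) + x (n + (4 * m + 4))
           = 4 ^ m * (7 * 4 ^ m * (x (Suc n) + x n) - (2 * x n - x (Suc n)))"
    unfolding e r2(1) o(1) r1 by (simp add: p)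
  show "2 * x (n + (4 * m + 4)) - x (Suc (n + (4 * m + 4))) = 4 ^ m * (x (Suc n) + x n)"
    unfolding e r2(2) o(2) r1 by (simp add: p)
qed

fun block_start :: "(nat \<Rightarrow> nat) \<Rightarrow> nat \<Rightarrow> nat" where
  "block_start m 0 = 0"
| "block_start m (Suc i) = block_start m i + (4 * m i + 4)"

text \<open>
  The infinite concatenation of the blocks, with positions counted from 0: an entry is 1
  exactly when it lies in the middle part of some block.
\<close>
definition block_word :: "(nat \<Rightarrow> nat) \<Rightarrow> nat \<Rightarrow> real" where
  "block_word m n = (if \<exists>i. n \<in> {block_start m i + 2 * m i ..< block_start m i + 2 * m i + 4}
                     then 1 else 2)"

lemma block_start_mono: "i \<le> j \<Longrightarrow> block_start m i \<le> block_start m j"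
  by (rule lift_Suc_mono_le[of "block_start m"]) auto

lemma block_start_ge: "i \<le> block_start m i"
  by (induction i) auto

lemma block_word_in_block:
  assumes "j < 4 * m i + 4"
  shows "block_word m (block_start m i + j) = (if 2 * m i \<le> j \<and> j < 2 * m i + 4 then 1 else 2)"
proof -
  have "i' = i" if "block_start m i + j \<in> {block_start m i' + 2 * m i' ..< block_start m i' + 2 * m i' + 4}" for i'
  proof (rule linorder_cases[of i i'])
    assume "i < i'"
    then have "block_start m (Suc i) \<le> block_start m i'" by (intro block_start_mono) auto
    with that assms show ?thesis by simp
  next
    assume "i' < i"
    then have "block_start m (Suc i') \<le> block_start m i" by (intro block_start_mono) auto
    with that assms show ?thesis by simp
  qed auto
  then have "(\<exists>i'. block_start m i + j \<in> {block_start m i' + 2 * m i' ..< block_start m i' + 2 * m i' + 4})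
      \<longleftrightarrow> block_start m i + j \<in> {block_start m i + 2 * m i ..< block_start m i + 2 * m i + 4}"
    by blast
  then show ?thesis unfolding block_word_def by simp
qed

text \<open>
  The values of \<open>X\<close> at the block boundaries without the accumulated powers of 4. The
  values of \<open>Y\<close> form the same sequence with a delay of one block, so the index is shifted: entry
  0 is the initial \<open>Y\<close>, and \<open>X\<close> at the start of block \<open>i\<close> is entry \<open>i + 1\<close>.
\<close>
fun block_seq :: "(nat \<Rightarrow> nat) \<Rightarrow> int \<Rightarrow> int \<Rightarrow> nat \<Rightarrow> int" where
  "block_seq m u v 0 = u"
| "block_seq m u v (Suc 0) = v"
| "block_seq m u v (Suc (Suc i)) = 7 * 4 ^ m i * block_seq m u v (Suc i) - block_seq m u v i"

lemma block_word_recurrence: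
  fixes x :: "nat \<Rightarrow> real"
  assumes rec: "\<And>n. x (Suc (Suc n)) = x (Suc n) + block_word m n * x n"
    and u: "2 * x 0 - x 1 = of_int u" and v: "x 1 + x 0 = of_int v"
  shows "x (Suc (block_start m i)) + x (block_start m i)
           = (\<Prod>j<i. 4 ^ m j) * of_int (block_seq m u v (Suc i))"
    and "2 * x (block_start m i) - x (Suc (block_start m i))
           = (\<Prod>j<i. 4 ^ m j) * of_int (block_seq m u v i)"
proof (induction i)
  case 0
  { case 1 show ?case using v by simp }
  { case 2 show ?case using u by simp }
next
  case (Suc i)
  have ones: "\<forall>j<4. block_word m (block_start m i + 2 * m i + j) = 1"
  proof (intro allI impI)
    fix j :: nat assume "j < 4"
    then show "block_word m (block_start m i + 2 * m i + j) = 1"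
      using block_word_in_block[of "2 * m i + j" m i] by (simp add: add.assoc)
  qed
  have twos: "\<forall>j<2 * m i. block_word m (block_start m i + j) = 2"
    using block_word_in_block[of _ m i] by simp
  have twos': "\<forall>j<2 * m i. block_word m (block_start m i + 2 * m i + 4 + j) = 2"
  proof (intro allI impI)
    fix j assume "j < 2 * m i"
    then show "block_word m (block_start m i + 2 * m i + 4 + j) = 2"
      using block_word_in_block[of "2 * m i + 4 + j" m i] by (simp add: add.assoc)
  qed
  note B = twos_ones_twos[of x "block_word m" "m i" "block_start m i", OF rec twos twos' ones]
  { case 1
    show ?case unfolding block_start.simps B(1) Suc.IH by (simp add: algebra_simps) }
  { case 2
    show ?case unfolding block_start.simps B(2) Suc.IH by (simp add: algebra_simps) }
qed

text \<open>
  The ratios are the mediants at the block boundaries, where the powers of 4 cancel.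
\<close>
lemma block_word_gcf:
  obtains a \<tau> where "\<forall>n\<ge>1. a n \<in> {1, 2}" "gcf_has_value a \<tau>"
    "(\<lambda>i. of_int (block_seq m 2 1 (Suc i)) / of_int (block_seq m (-1) 1 (Suc i))) \<longlonglongrightarrow> \<tau>"
proof -
  define a where "a n = block_word m (n - 1)" for n
  have a: "a n \<in> {1, 2}" for n by (auto simp: a_def block_word_def)
  have a0: "0 \<le> a n" "a n \<le> 2" for n using a[of n] by auto
  obtain \<tau> where \<tau>: "gcf_has_value a \<tau>"
    using gcf_convergent[of a] a0 by (auto simp: convergent_def gcf_has_value_def)
  \<comment> \<open>Prepending the conventional entries \<open>A (-1) = 1\<close> and \<open>B (-1) = 0\<close> makes the recurrence hold
    from the first partial numerator on.\<close>
  define x where "x = case_nat 1 (gcf_num a)"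
  define y where "y = case_nat 0 (gcf_den a)"
  have x: "x (Suc (Suc n)) = x (Suc n) + block_word m n * x n" for n
    by (cases n) (auto simp: x_def a_def)
  have y: "y (Suc (Suc n)) = y (Suc n) + block_word m n * y n" for n
    by (cases n) (auto simp: y_def a_def)
  have X: "x (Suc (block_start m i)) + x (block_start m i)
           = (\<Prod>j<i. 4 ^ m j) * of_int (block_seq m 2 1 (Suc i))" for i
    by (rule block_word_recurrence[OF x]) (auto simp: x_def)
  have Y: "y (Suc (block_start m i)) + y (block_start m i)
           = (\<Prod>j<i. 4 ^ m j) * of_int (block_seq m (-1) 1 (Suc i))" for i
    by (rule block_word_recurrence[OF y]) (auto simp: y_def)
  have "(\<lambda>n. (x (Suc n) + x n) / (y (Suc n) + y n)) \<longlonglongrightarrow> \<tau>"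
    by (rule LIMSEQ_imp_Suc) (use gcf_mediants_tendsto[OF a0(1) \<tau>] in \<open>simp add: x_def y_def\<close>)
  moreover have "filterlim (block_start m) sequentially sequentially"
    by (rule filterlim_at_top_mono[OF filterlim_ident]) (simp add: block_start_ge)
  ultimately have "(\<lambda>i. (x (Suc (block_start m i)) + x (block_start m i))
      / (y (Suc (block_start m i)) + y (block_start m i))) \<longlonglongrightarrow> \<tau>"
    by (rule filterlim_compose)
  then have main: "(\<lambda>i. of_int (block_seq m 2 1 (Suc i)) / of_int (block_seq m (-1) 1 (Suc i))) \<longlonglongrightarrow> \<tau>"
    unfolding X Y by simp
  show thesis by (rule that[OF _ \<tau> main]) (intro allI impI a)
qed

section \<open>The approximations at the block boundaries\<close>
lemma block_seq_det:
  "block_seq m u v (Suc i) * block_seq m u' v' i - block_seq m u v i * block_seq m u' v' (Suc i)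
     = v * u' - u * v'"
proof (induction i)
  case (Suc i)
  have "(c * x - w) * y - x * (c * y - z) = x * z - w * y" for c w x y z :: int
    by (simp add: algebra_simps)
  then show ?case unfolding block_seq.simps Suc.IH[symmetric] .
qed simp

lemma block_den_growth:
  fixes m :: "nat \<Rightarrow> nat"
  defines "q \<equiv> block_seq m (-1) 1"
  shows "1 \<le> q (Suc i)" "\<bar>q i\<bar> \<le> q (Suc i)"
    "6 * 4 ^ m i * q (Suc i) \<le> q (Suc (Suc i))" "q (Suc (Suc i)) \<le> 8 * 4 ^ m i * q (Suc i)"
proof -
  have step: "6 * 4 ^ m i * q (Suc i) \<le> q (Suc (Suc i)) \<and> q (Suc (Suc i)) \<le> 8 * 4 ^ m i * q (Suc i)"
    if "1 \<le> q (Suc i)" "\<bar>q i\<bar> \<le> q (Suc i)" for i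
  proof -
    have "1 * q (Suc i) \<le> 4 ^ m i * q (Suc i)"
      using that by (intro mult_right_mono) auto
    then show ?thesis using that(2) unfolding q_def block_seq.simps by linarith
  qed
  have main: "1 \<le> q (Suc i) \<and> \<bar>q i\<bar> \<le> q (Suc i)" for i
  proof (induction i)
    case 0 show ?case by (simp add: q_def)
  next
    case (Suc i)
    have "6 * 1 * q (Suc i) \<le> 6 * 4 ^ m i * q (Suc i)"
      using Suc by (intro mult_right_mono mult_left_mono) auto
    then have "6 * q (Suc i) \<le> q (Suc (Suc i))" using step[of i] Suc by linarith
    with Suc show ?case by linarith
  qed
  show "1 \<le> q (Suc i)" "\<bar>q i\<bar> \<le> q (Suc i)"
    "6 * 4 ^ m i * q (Suc i) \<le> q (Suc (Suc i))" "q (Suc (Suc i)) \<le> 8 * 4 ^ m i * q (Suc i)"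
    using main step by blast+
qed

lemma block_den_gt_index: "int i < block_seq m (-1) 1 (Suc i)"
proof (induction i)
  case (Suc i)
  have "6 * 1 * block_seq m (-1) 1 (Suc i) \<le> 6 * 4 ^ m i * block_seq m (-1) 1 (Suc i)"
    using block_den_growth(1)[of m i] by (intro mult_right_mono mult_left_mono) auto
  with block_den_growth(3)[of m i] Suc show ?case unfolding of_nat_Suc by linarith
qed simp

text \<open>
  By the determinant, \<open>p / q\<close> decreases in steps of \<open>3 / (q i * q (i + 1))\<close>. The first step
  alone gives the lower bound; since \<open>q\<close> grows at least sixfold, the remaining steps together are
  smaller than the first one, which gives the upper bound.
\<close>
lemma block_approximation:
  fixes m :: "nat \<Rightarrow> nat" and \<tau> :: real
  defines "p \<equiv> block_seq m 2 1" and "q \<equiv> block_seq m (-1) 1"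
  assumes lim: "(\<lambda>i. of_int (p (Suc i)) / of_int (q (Suc i))) \<longlonglongrightarrow> \<tau>"
  shows "3 / of_int (q (Suc (Suc i))) \<le> of_int (p (Suc i)) - of_int (q (Suc i)) * \<tau>"
    and "of_int (p (Suc i)) - of_int (q (Suc i)) * \<tau> \<le> 6 / of_int (q (Suc (Suc i)))"
proof -
  define P R where "P i = real_of_int (p (Suc i))" and "R i = real_of_int (q (Suc i))" for i
  note g = block_den_growth[of m, folded q_def]
  have R0: "0 < R i" for i using g(1)[of i] by (simp add: R_def)
  have R6: "6 * R i \<le> R (Suc i)" for i
  proof -
    have "6 * 1 * q (Suc i) \<le> 6 * 4 ^ m i * q (Suc i)"
      using g(1)[of i] by (intro mult_right_mono mult_left_mono) auto
    then have "6 * q (Suc i) \<le> q (Suc (Suc i))" using g(3)[of i] by linarith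
    then show ?thesis unfolding R_def by linarith
  qed
  have det: "P (Suc i) * R i - P i * R (Suc i) = -3" for i
  proof -
    have "p (Suc (Suc i)) * q (Suc i) - p (Suc i) * q (Suc (Suc i)) = -3"
      unfolding p_def q_def by (subst block_seq_det) simp
    then show ?thesis unfolding P_def R_def
      by (metis (no_types, lifting) of_int_diff of_int_minus of_int_mult of_int_numeral)
  qed
  have step: "P i / R i - P (Suc i) / R (Suc i) = 3 / (R i * R (Suc i))" for i
    using det[of i] R0[of i] R0[of "Suc i"] by (simp add: field_simps)
  have lim': "(\<lambda>i. P i / R i) \<longlonglongrightarrow> \<tau>" using lim by (simp add: P_def R_def)
  have dec: "decseq (\<lambda>i. P i / R i)"
    unfolding decseq_Suc_iff
  proof
    fix i
    have "0 \<le> 3 / (R i * R (Suc i))" using R0[of i] R0[of "Suc i"] by simp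
    with step[of i] show "P (Suc i) / R (Suc i) \<le> P i / R i" by linarith
  qed
  have "\<tau> \<le> P (Suc i) / R (Suc i)" by (rule decseq_ge[OF dec lim'])
  then have "3 / (R i * R (Suc i)) \<le> P i / R i - \<tau>"
    using step[of i] by linarith
  then have "R i * (3 / (R i * R (Suc i))) \<le> R i * (P i / R i - \<tau>)"
    using R0[of i] by (intro mult_left_mono) auto
  then show "3 / of_int (q (Suc (Suc i))) \<le> of_int (p (Suc i)) - of_int (q (Suc i)) * \<tau>"
    using R0[of i] by (simp add: right_diff_distrib flip: P_def R_def)
  \<comment> \<open>The upper bound says that these numbers stay below the limit of \<open>P i / R i\<close>; it suffices
    that they increase.\<close>
  let ?l = "\<lambda>i. P i / R i - 6 / (R i * R (Suc i))"
  have inc: "incseq ?l"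
    unfolding incseq_Suc_iff
  proof
    fix i
    have "2 * R i \<le> R (Suc (Suc i))" using R6[of i] R6[of "Suc i"] R0[of i] by linarith
    then have "(2 * R i) * (3 * R (Suc i)) \<le> R (Suc (Suc i)) * (3 * R (Suc i))"
      using R0[of "Suc i"] by (intro mult_right_mono) auto
    then have "6 / (R (Suc i) * R (Suc (Suc i))) \<le> 3 / (R i * R (Suc i))"
      using R0[of i] R0[of "Suc i"] R0[of "Suc (Suc i)"]
      by (intro frac_le_eq[THEN iffD2] divide_nonpos_pos) (auto simp: algebra_simps mult_le_cancel_left)
    then show "?l i \<le> ?l (Suc i)" using step[of i] by simp
  qed
  have "?l i \<le> \<tau>"
  proof (rule LIMSEQ_le_const[OF lim'], intro exI allI impI)
    fix n assume "i \<le> n"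
    then have "?l i \<le> ?l n" using inc by (simp add: incseq_def)
    moreover have "0 \<le> 6 / (R n * R (Suc n))" using R0[of n] R0[of "Suc n"] by simp
    ultimately show "?l i \<le> P n / R n" by linarith
  qed
  then have "R i * (P i / R i - \<tau>) \<le> R i * (6 / (R i * R (Suc i)))"
    using R0[of i] by (intro mult_left_mono) auto
  then show "of_int (p (Suc i)) - of_int (q (Suc i)) * \<tau> \<le> 6 / of_int (q (Suc (Suc i)))"
    using R0[of i] by (simp add: right_diff_distrib flip: P_def R_def)
qed

section \<open>Irrationality exponents from one sequence of approximations\<close>

text \<open>
  Given \<open>M / N\<close>, let \<open>i\<close> be the index just before \<open>R\<close> first reaches \<open>2 * K * N\<close>. Then \<open>\<tau>\<close> is so close to \<open>P i / R i\<close> that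
  any other fraction with denominator \<open>N\<close> has distance at least \<open>1 / (2 * N * R i)\<close>, of order
  \<open>1 / N\<^sup>2\<close>, from \<open>\<tau>\<close>. If \<open>M / N\<close> equals \<open>P i / R i\<close>, the assumed lower bound applies, and
  \<open>N\<close> cannot be much smaller than \<open>R i\<close> because a common factor of \<open>P i\<close> and \<open>R i\<close> divides the
  determinant.
\<close>
lemma irrationality_exponentI:
  fixes P R :: "nat \<Rightarrow> int" and D :: int and \<tau> c K s :: real
  assumes R: "\<And>i. 0 < R i" and unbdd: "\<And>B :: real. \<exists>i. B \<le> R i"
    and det: "\<And>i. P (Suc i) * R i - P i * R (Suc i) = D" and D: "D \<noteq> 0"
    and upper: "\<And>i. \<bar>P i - R i * \<tau>\<bar> \<le> K / R (Suc i)"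
    and lower: "\<And>i. c / R i powr (s - 1) \<le> \<bar>P i - R i * \<tau>\<bar>"
    and c: "0 < c" and s: "2 \<le> s"
  shows "irrationality_exponent \<tau> s"
proof -
  have "0 < c / R 0 powr (s - 1)" using c R[of 0] by simp
  also have "\<dots> \<le> K / R (Suc 0)" using lower upper by (rule order_trans)
  finally have K: "0 < K" using R[of "Suc 0"] by (simp add: zero_less_divide_iff)
  \<comment> \<open>The threshold ensures \<open>R 0 < 2 * K * N\<close>, so that such an index \<open>i\<close> exists.\<close>
  define N0 where "N0 = R 0 / (2 * K) + 1"
  define C where "C = min (1 / (4 * K)) (c / \<bar>real_of_int D\<bar> powr s)"
  have C: "0 < C" using K c D by (simp add: C_def)
  have "C / N powr s \<le> \<bar>\<tau> - M / N\<bar>" if N: "N0 \<le> real_of_int N" for M N :: int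
  proof -
    have "0 < R 0 / (2 * K)" using R[of 0] K by simp
    then have N1: "1 \<le> real_of_int N" using N unfolding N0_def by linarith
    then have Npos: "0 < real_of_int N" by linarith
    have "R 0 / (2 * K) < N" using N unfolding N0_def by linarith
    then have R0: "R 0 < 2 * K * N" using K by (simp add: field_simps)
    define j where "j = (LEAST j. 2 * K * N \<le> R j)"
    have j: "2 * K * N \<le> R j"
      unfolding j_def using unbdd by (rule LeastI_ex)
    have "j \<noteq> 0" using j R0 by (intro notI) simp
    then obtain i where i: "j = Suc i" by (cases j) auto
    have Ri: "R i < 2 * K * N"
      using not_less_Least[of i "\<lambda>j. 2 * K * N \<le> R j"] i unfolding j_def by auto
    have Ripos: "0 < real_of_int (R i)" using R by simp
    have Rjpos: "0 < real_of_int (R (Suc i))" using R by simp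
    have split: "\<bar>\<tau> - P i / R i\<bar> = \<bar>P i - R i * \<tau>\<bar> / R i"
    proof -
      have "\<tau> - P i / R i = - ((P i - R i * \<tau>) / R i)" using Ripos by (simp add: field_simps)
      then show ?thesis using Ripos by (simp add: abs_divide)
    qed
    show ?thesis
    proof (cases "M * R i = N * P i")
      case False
      have "\<bar>P i - R i * \<tau>\<bar> \<le> K / R (Suc i)" by (rule upper)
      also have "\<dots> \<le> K / (2 * K * N)"
        using j K Npos Rjpos unfolding i by (intro divide_left_mono mult_pos_pos) auto
      also have "\<dots> = 1 / (2 * N)" using K by simp
      finally have small: "\<bar>\<tau> - P i / R i\<bar> \<le> 1 / (2 * N) / R i"
        unfolding split using Ripos by (intro divide_right_mono) auto
      have "1 \<le> \<bar>N * P i - M * R i\<bar>" using False by linarith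
      then have "1 \<le> \<bar>real_of_int N * P i - M * R i\<bar>" 
        by (metis of_int_1 of_int_abs of_int_diff of_int_le_iff of_int_mult)
      then have "1 / (N * R i) \<le> \<bar>real_of_int N * P i - M * R i\<bar> / (N * R i)"
        using Npos Ripos by (intro divide_right_mono) auto
      also have "\<dots> = \<bar>P i / R i - M / N\<bar>"
      proof -
        have "P i / R i - M / N = (real_of_int N * P i - M * R i) / (N * R i)"
          using Npos Ripos by (simp add: field_simps)
        then show ?thesis using Npos Ripos by (simp add: abs_divide abs_mult)
      qed
      finally have "1 / (N * R i) \<le> \<bar>P i / R i - M / N\<bar>" .
      then have "1 / (N * R i) - 1 / (2 * N) / R i \<le> \<bar>\<tau> - M / N\<bar>"
        using small by linarith
      moreover have "1 / (N * R i) - 1 / (2 * N) / R i = 1 / (2 * N * R i)"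
        using Npos Ripos by (simp add: field_simps)
      moreover have "1 / (2 * N * (2 * K * N)) \<le> 1 / (2 * N * R i)"
        using Ri K Npos Ripos by (intro divide_left_mono mult_left_mono mult_pos_pos) auto
      moreover have "C / N powr s \<le> (1 / (4 * K)) / N powr 2"
        using C s N1 K by (intro frac_le powr_mono) (auto simp: C_def)
      moreover have "(1 / (4 * K)) / N powr 2 = 1 / (2 * N * (2 * K * N))"
        using Npos by (simp add: power2_eq_square)
      ultimately show ?thesis by linarith
    next
      case True
      have "N * (P (Suc i) * R i - P i * R (Suc i)) = R i * (N * P (Suc i) - M * R (Suc i))"
        using True by (simp add: algebra_simps)
      then have "R i dvd N * D" unfolding det by simp
      moreover have "N * D \<noteq> 0" using D N1 by auto
      ultimately have "\<bar>R i\<bar> \<le> \<bar>N * D\<bar>" by (rule dvd_imp_le_int[rotated])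
      then have "real_of_int \<bar>R i\<bar> \<le> real_of_int \<bar>N * D\<bar>" by (simp only: of_int_le_iff)
      then have RD: "R i \<le> \<bar>real_of_int D\<bar> * N"
        using Npos Ripos by (simp add: abs_mult mult.commute)
      have "C / N powr s \<le> (c / \<bar>real_of_int D\<bar> powr s) / N powr s"
        by (intro divide_right_mono) (auto simp: C_def)
      also have "\<dots> = c / (\<bar>real_of_int D\<bar> * N) powr s"
        using Npos by (simp add: powr_mult)
      also have "\<dots> \<le> c / R i powr s"
        using c RD Ripos s Npos D by (intro divide_left_mono powr_mono2 mult_pos_pos) auto
      also have "\<dots> = c / R i powr (s - 1) / R i"
        using Ripos by (simp add: powr_diff)
      also have "\<dots> \<le> \<bar>P i - R i * \<tau>\<bar> / R i"
        using lower Ripos by (intro divide_right_mono) auto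
      also have "\<dots> = \<bar>\<tau> - M / N\<bar>"
      proof -
        have "real_of_int M * R i = N * P i" using True by (metis of_int_mult)
        then have "M / N = P i / R i" using Npos Ripos by (simp add: field_simps)
        then show ?thesis using split by simp
      qed
      finally show ?thesis .
    qed
  qed
  moreover have "0 < N0" using R[of 0] K by (simp add: N0_def add_pos_pos)
  ultimately show ?thesis unfolding irrationality_exponent_def using C
    by (intro exI[of _ C] exI[of _ N0]) simp
qed

text \<open>
  An exponent \<open>\<mu>\<close> would force \<open>c * R i powr (\<nu> - \<mu>) \<le> C\<close> for all large \<open>i\<close>.
\<close>
lemma not_irrationality_exponentI:
  fixes P R :: "nat \<Rightarrow> int" and \<tau> C \<mu> \<nu> :: real
  assumes R: "filterlim (\<lambda>i. real_of_int (R i)) at_top sequentially"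
    and nz: "\<And>i. P i \<noteq> R i * \<tau>"
    and upper: "eventually (\<lambda>i. \<bar>P i - R i * \<tau>\<bar> \<le> C / R i powr (\<nu> - 1)) sequentially"
    and less: "\<mu> < \<nu>"
  shows "\<not> irrationality_exponent \<tau> \<mu>"
proof
  assume "irrationality_exponent \<tau> \<mu>"
  then obtain c N0 :: real where c: "0 < c" and exp:
    "\<And>(M :: int) (N :: int). N0 \<le> N \<Longrightarrow> M / N \<noteq> \<tau> \<Longrightarrow> c / N powr \<mu> \<le> \<bar>\<tau> - M / N\<bar>"
    unfolding irrationality_exponent_def by blast
  have "eventually (\<lambda>i. (\<bar>C / c\<bar> + 1) powr (1 / (\<nu> - \<mu>)) \<le> R i) sequentially"
    using R by (simp add: filterlim_at_top)
  then have "eventually (\<lambda>i. C / c < R i powr (\<nu> - \<mu>)) sequentially"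
  proof eventually_elim
    case (elim i)
    have "C / c < \<bar>C / c\<bar> + 1" by linarith
    also have "\<dots> = ((\<bar>C / c\<bar> + 1) powr (1 / (\<nu> - \<mu>))) powr (\<nu> - \<mu>)"
      using less by (simp add: powr_powr)
    also have "\<dots> \<le> R i powr (\<nu> - \<mu>)"
      using elim less by (intro powr_mono2) auto
    finally show ?case .
  qed
  moreover have "eventually (\<lambda>i. max N0 1 \<le> R i) sequentially"
    using R unfolding filterlim_at_top by (rule spec)
  ultimately have "eventually (\<lambda>i. False) sequentially"
    using upper
  proof eventually_elim
    case (elim i)
    then have Rpos: "0 < real_of_int (R i)" by auto
    have "\<tau> - P i / R i = - ((P i - R i * \<tau>) / R i)" using Rpos by (simp add: field_simps)
    then have split: "\<bar>\<tau> - P i / R i\<bar> = \<bar>P i - R i * \<tau>\<bar> / R i" using Rpos by (simp add: abs_divide)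
    have "P i / R i \<noteq> \<tau>" using nz[of i] Rpos by (auto simp: field_simps)
    then have "c / R i powr \<mu> \<le> \<bar>P i - R i * \<tau>\<bar> / R i"
      using exp[of "R i" "P i"] elim by (simp flip: split)
    also have "\<dots> \<le> C / R i powr (\<nu> - 1) / R i"
      using elim Rpos by (intro divide_right_mono) auto
    also have "\<dots> = C / R i powr \<nu>" using Rpos by (simp add: powr_diff)
    finally have "c * (R i powr \<nu> / R i powr \<mu>) \<le> C" using Rpos by (simp add: field_simps)
    then have "R i powr (\<nu> - \<mu>) \<le> C / c" using c by (simp add: powr_diff field_simps)
    then show False using elim by simp
  qed
  then show False by simp
qed

section \<open>Prescribing the exponent\<close>

lemma asymptotic_irrationality_exponent_eqI:
  assumes "irrationality_exponent \<tau> s" and "\<And>\<mu>. \<mu> < s \<Longrightarrow> \<not> irrationality_exponent \<tau> \<mu>"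
  shows "\<mu>\<^sub>I \<tau> = ereal s"
  unfolding asymptotic_irrationality_exponent_def
proof (rule Inf_eqI)
  fix e assume "e \<in> ereal ` {\<mu>. irrationality_exponent \<tau> \<mu>}"
  then show "ereal s \<le> e" using assms(2) by (force simp: not_less[symmetric])
qed (use assms(1) in auto)

text \<open>
  A fraction other than 1 differs from 1 by at least \<open>1 / N\<close>, and \<open>(N + 1) / N\<close> attains this.
\<close>
lemma asymptotic_irrationality_exponent_1: "\<mu>\<^sub>I 1 = 1"
proof -
  have "irrationality_exponent 1 1"
    unfolding irrationality_exponent_def
  proof (rule exI[of _ 1], rule exI[of _ 1], intro conjI allI impI)
    fix M N :: int
    assume *: "1 \<le> real_of_int N \<and> real_of_int M / real_of_int N \<noteq> 1"
    then have "1 \<le> \<bar>N - M\<bar>" by auto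
    then have "1 \<le> \<bar>real_of_int N - M\<bar>" by linarith
    then have "1 / N \<le> \<bar>real_of_int N - M\<bar> / N" using * by (intro divide_right_mono) auto
    also have "\<dots> = \<bar>1 - M / N\<bar>"
    proof -
      have "1 - M / N = (real_of_int N - M) / N" using * by (simp add: field_simps)
      then show ?thesis using * by (simp add: abs_divide)
    qed
    finally show "1 / real_of_int N powr 1 \<le> \<bar>1 - M / N\<bar>" using * by simp
  qed auto
  moreover have "\<not> irrationality_exponent 1 \<mu>" if "\<mu> < 1" for \<mu>
  proof (rule not_irrationality_exponentI[of "\<lambda>i. int (Suc i)" "\<lambda>i. int (Suc (Suc i))" _ 1, OF _ _ _ that])
    show "filterlim (\<lambda>i. real_of_int (int (Suc i))) at_top sequentially"
      using filterlim_compose[OF filterlim_real_sequentially filterlim_Suc] by (simp add: o_def)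
  qed auto
  ultimately show ?thesis
    unfolding one_ereal_def by (rule asymptotic_irrationality_exponent_eqI)
qed

text \<open>
  The difference \<open>B n - A n\<close> belongs to the root \<open>-1\<close> of the recurrence, so it stays bounded while \<open>B n\<close> tends to infinity.
\<close>
lemma gcf_of_twos: "gcf_has_value (\<lambda>_. 2) 1"
proof -
  let ?A = "gcf_num (\<lambda>_. 2)" and ?B = "gcf_den (\<lambda>_. 2)"
  have AB: "?A n = ?B n - (-1) ^ n \<and> ?A (Suc n) = ?B (Suc n) - (-1) ^ Suc n" for n
  proof (induction n)
    case (Suc n)
    then show ?case unfolding gcf_num.simps gcf_den.simps by (simp only:) (simp add: algebra_simps)
  qed simp
  have Bn: "1 \<le> ?B n" for n by (rule gcf_den_ge_1) simp
  have B: "real n \<le> ?B n" for n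
  proof (induction n)
    case (Suc n)
    show ?case
    proof (cases n)
      case (Suc k)
      with Suc.IH Bn[of k] show ?thesis unfolding Suc gcf_den.simps by linarith
    qed simp
  qed simp
  have "(\<lambda>n. (-1) ^ n / ?B n) \<longlonglongrightarrow> 0"
  proof (rule Lim_null_comparison[OF _ lim_1_over_n])
    have "norm ((-1) ^ n / ?B n) \<le> 1 / real n" if "1 \<le> n" for n
      using B[of n] Bn[of n] that by (simp add: power_abs abs_divide frac_le)
    then show "\<forall>\<^sub>F n in sequentially. norm ((-1) ^ n / ?B n) \<le> 1 / real n"
      by (auto simp: eventually_sequentially)
  qed
  from tendsto_diff[OF tendsto_const[of 1] this]
  have "(\<lambda>n. 1 - (-1) ^ n / ?B n) \<longlonglongrightarrow> 1" by simp
  moreover have "1 - (-1) ^ n / ?B n = ?A n / ?B n" for n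
  proof -
    have "?A n / ?B n = (?B n - (-1) ^ n) / ?B n" by (simp only: AB)
    also have "\<dots> = 1 - (-1) ^ n / ?B n" using Bn[of n] by (simp add: diff_divide_distrib)
    finally show ?thesis by simp
  qed
  ultimately show ?thesis by (simp add: gcf_has_value_def)
qed

text \<open>
  The sequence \<open>block_seq\<close> takes all block lengths as given in advance, whereas the length of each
  block has to depend on the denominator reached so far. This recursion produces the denominators
  and the lengths together.
\<close>
fun adaptive_den :: "(nat \<Rightarrow> int \<Rightarrow> nat) \<Rightarrow> nat \<Rightarrow> int" where
  "adaptive_den g 0 = -1"
| "adaptive_den g (Suc 0) = 1"
| "adaptive_den g (Suc (Suc i))
     = 7 * 4 ^ g i (adaptive_den g (Suc i)) * adaptive_den g (Suc i) - adaptive_den g i"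

lemma adaptive_block_lengths:
  obtains m where "\<forall>i. m i = g i (block_seq m (-1) 1 (Suc i))"
proof
  define m where "m i = g i (adaptive_den g (Suc i))" for i
  have "block_seq m (-1) 1 i = adaptive_den g i
      \<and> block_seq m (-1) 1 (Suc i) = adaptive_den g (Suc i)" for i
    by (induction i) (simp_all add: m_def)
  then have *: "block_seq m (-1) 1 i = adaptive_den g i" for i by blast
  show "\<forall>i. m i = g i (block_seq m (-1) 1 (Suc i))"
    unfolding * by (simp add: m_def)
qed

lemma adaptive_gcf:
  obtains a \<tau> P R where
    "\<forall>n\<ge>1. a n \<in> {1, 2}" "gcf_has_value a \<tau>"
    "\<forall>i. 0 < R i" "filterlim (\<lambda>i. real_of_int (R i)) at_top sequentially"
    "\<forall>i. P (Suc i) * R i - P i * R (Suc i) = -3"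
    "\<forall>i. 3 / R (Suc i) \<le> P i - R i * \<tau>" "\<forall>i. P i - R i * \<tau> \<le> 6 / R (Suc i)"
    "\<forall>i. 6 * 4 ^ g i (R i) * R i \<le> R (Suc i)" "\<forall>i. R (Suc i) \<le> 8 * 4 ^ g i (R i) * R i"
proof -
  obtain m where m: "\<forall>i. m i = g i (block_seq m (-1) 1 (Suc i))"
    by (rule adaptive_block_lengths[of g])
  obtain a \<tau> where a: "\<forall>n\<ge>1. a n \<in> {1, 2}" "gcf_has_value a \<tau>" and lim:
    "(\<lambda>i. of_int (block_seq m 2 1 (Suc i)) / of_int (block_seq m (-1) 1 (Suc i))) \<longlonglongrightarrow> \<tau>"
    by (rule block_word_gcf[of m])
  define P where "P i = block_seq m 2 1 (Suc i)" for i
  define R where "R i = block_seq m (-1) 1 (Suc i)" for i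
  have R0: "0 < R i" for i using block_den_growth(1)[of m i] by (simp add: R_def)
  have det: "P (Suc i) * R i - P i * R (Suc i) = -3" for i
    unfolding P_def R_def by (subst block_seq_det) simp
  have app: "3 / R (Suc i) \<le> P i - R i * \<tau>" "P i - R i * \<tau> \<le> 6 / R (Suc i)" for i
    unfolding P_def R_def by (rule block_approximation[OF lim])+
  have growth: "6 * 4 ^ g i (R i) * R i \<le> R (Suc i)" "R (Suc i) \<le> 8 * 4 ^ g i (R i) * R i" for i
    using block_den_growth(3,4)[of m i] unfolding m[rule_format, of i] by (simp_all only: R_def)
  have "real i \<le> real_of_int (R i)" for i
    using block_den_gt_index[of i m] unfolding R_def by linarith
  then have "filterlim (\<lambda>i. real_of_int (R i)) at_top sequentially"
    by (intro filterlim_at_top_mono[OF filterlim_real_sequentially]) auto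
  from that[OF a allI[OF R0] this allI[OF det] allI[OF app(1)] allI[OF app(2)]
      allI[OF growth(1)] allI[OF growth(2)]]
  show thesis .
qed

text \<open>
  The block lengths are chosen such that \<open>R i powr (s - 2) / 4 \<le> 4 ^ m i \<le> R i powr (s - 2)\<close>. Then
  \<open>R (i + 1)\<close> equals \<open>R i powr (s - 1)\<close> up to constant factors, and so does the reciprocal of
  \<open>P i - R i * \<tau>\<close>. Here \<open>s \<ge> 2\<close> makes such lengths exist.
\<close>
lemma gcf_with_finite_exponent:
  fixes s :: real
  assumes s: "2 \<le> s"
  shows "\<exists>a \<tau>. (\<forall>n\<ge>1. a n \<in> {1, 2}) \<and> gcf_has_value a \<tau> \<and> \<mu>\<^sub>I \<tau> = ereal s"
proof -
  define g :: "nat \<Rightarrow> int \<Rightarrow> nat" where "g i r = nat \<lfloor>(s - 2) * log 4 r\<rfloor>" for i r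
  obtain a \<tau> P R where a: "\<forall>n\<ge>1. a n \<in> {1, 2}" "gcf_has_value a \<tau>"
    and R: "\<forall>i. 0 < R i" and Rlim: "filterlim (\<lambda>i. real_of_int (R i)) at_top sequentially"
    and det: "\<forall>i. P (Suc i) * R i - P i * R (Suc i) = -3"
    and app: "\<forall>i. 3 / R (Suc i) \<le> P i - R i * \<tau>" "\<forall>i. P i - R i * \<tau> \<le> 6 / R (Suc i)"
    and gr: "\<forall>i. 6 * 4 ^ g i (R i) * R i \<le> R (Suc i)" "\<forall>i. R (Suc i) \<le> 8 * 4 ^ g i (R i) * R i"
    by (rule adaptive_gcf[of g])
  note R0 = R[rule_format] and det = det[rule_format] and app = app[rule_format] and gr = gr[rule_format]
  have pos: "0 < real_of_int (R i)" for i using R0 by simp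
  have g4: "4 ^ g i (R i) \<le> R i powr (s - 2)" "R i powr (s - 2) \<le> 4 * 4 ^ g i (R i)" for i
  proof -
    let ?y = "(s - 2) * log 4 (R i)"
    have "1 \<le> real_of_int (R i)" using R0[of i] by simp
    then have y: "0 \<le> ?y" using s by simp
    have p: "R i powr (s - 2) = 4 powr ?y"
    proof -
      have "4 powr ?y = (4 powr log 4 (R i)) powr (s - 2)" by (simp only: powr_powr mult.commute)
      then show ?thesis using pos[of i] by simp
    qed
    have q: "(4::real) ^ g i (R i) = 4 powr real (g i (R i))" by (simp add: powr_realpow)
    have f: "real (g i (R i)) = \<lfloor>?y\<rfloor>" using y by (simp add: g_def)
    show "4 ^ g i (R i) \<le> R i powr (s - 2)"
      unfolding p q by (rule powr_mono) (auto simp: f)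
    have "4 powr ?y \<le> (4::real) powr (1 + g i (R i))"
      by (rule powr_mono) (auto simp: f, linarith)
    then show "R i powr (s - 2) \<le> 4 * 4 ^ g i (R i)"
      unfolding p by (simp add: powr_add powr_realpow)
  qed
  have e: "R i powr (s - 1) = R i powr (s - 2) * R i" for i
    using pos[of i] by (simp add: powr_diff power2_eq_square field_simps)
  have up: "R (Suc i) \<le> 8 * R i powr (s - 1)" for i
  proof -
    have "real_of_int (R (Suc i)) \<le> 8 * 4 ^ g i (R i) * real_of_int (R i)"
      using gr(2)[of i, folded of_int_le_iff[where 'a = real]] by simp
    also have "\<dots> \<le> 8 * R i powr (s - 2) * R i"
      using g4(1)[of i] pos[of i] by (intro mult_right_mono mult_left_mono) auto
    finally show ?thesis by (simp add: e)
  qed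
  have lo: "3 / 2 * R i powr (s - 1) \<le> R (Suc i)" for i
  proof -
    have "3 / 2 * R i powr (s - 2) * R i \<le> 3 / 2 * (4 * 4 ^ g i (R i)) * R i"
      using g4(2)[of i] pos[of i] by (intro mult_right_mono mult_left_mono) auto
    also have "\<dots> \<le> R (Suc i)"
      using gr(1)[of i, folded of_int_le_iff[where 'a = real]] by simp
    finally show ?thesis by (simp add: e)
  qed
  have gap0: "0 < P i - R i * \<tau>" for i
    using app(1)[of i] pos[of "Suc i"] by (smt (verit) divide_pos_pos)
  have "irrationality_exponent \<tau> s"
  proof (rule irrationality_exponentI[of R P "-3", OF R0 _ det])
    show "\<exists>i. B \<le> R i" for B :: real
      using Rlim by (auto simp: filterlim_at_top eventually_sequentially)
    show "\<bar>P i - R i * \<tau>\<bar> \<le> 6 / R (Suc i)" for i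
      using app(2)[of i] gap0[of i] by simp
    show "(3 / 8) / R i powr (s - 1) \<le> \<bar>P i - R i * \<tau>\<bar>" for i
    proof -
      have "3 / (8 * R i powr (s - 1)) \<le> 3 / R (Suc i)"
        using up[of i] pos[of i] pos[of "Suc i"] by (intro divide_left_mono) auto
      then show ?thesis using app(1)[of i] gap0[of i] by simp
    qed
  qed (use s in auto)
  moreover have "\<not> irrationality_exponent \<tau> \<mu>" if "\<mu> < s" for \<mu>
  proof (rule not_irrationality_exponentI[of R P, OF Rlim _ _ that])
    show "P i \<noteq> R i * \<tau>" for i using gap0[of i] by simp
    have "\<bar>P i - R i * \<tau>\<bar> \<le> 4 / R i powr (s - 1)" for i
    proof -
      have "6 / R (Suc i) \<le> 6 / (3 / 2 * R i powr (s - 1))"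
        using lo[of i] pos[of i] pos[of "Suc i"] by (intro divide_left_mono) auto
      then show ?thesis using app(2)[of i] gap0[of i] by simp
    qed
    then show "\<forall>\<^sub>F i in sequentially. \<bar>P i - R i * \<tau>\<bar> \<le> 4 / R i powr (s - 1)" by simp
  qed
  ultimately show ?thesis using a asymptotic_irrationality_exponent_eqI by blast
qed

text \<open>
  With \<open>m i = R i * i\<close> one has \<open>4 ^ m i \<ge> R i ^ i\<close>, so the approximations beat every fixed power of
  the denominator.
\<close>
lemma gcf_with_infinite_exponent:
  "\<exists>a \<tau>. (\<forall>n\<ge>1. a n \<in> {1, 2}) \<and> gcf_has_value a \<tau> \<and> \<mu>\<^sub>I \<tau> = \<infinity>"
proof -
  define g :: "nat \<Rightarrow> int \<Rightarrow> nat" where "g i r = nat r * i" for i r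
  obtain a \<tau> P R where a: "\<forall>n\<ge>1. a n \<in> {1, 2}" "gcf_has_value a \<tau>"
    and R: "\<forall>i. 0 < R i" and Rlim: "filterlim (\<lambda>i. real_of_int (R i)) at_top sequentially"
    and "\<forall>i. P (Suc i) * R i - P i * R (Suc i) = -3"
    and app: "\<forall>i. 3 / R (Suc i) \<le> P i - R i * \<tau>" "\<forall>i. P i - R i * \<tau> \<le> 6 / R (Suc i)"
    and gr: "\<forall>i. 6 * 4 ^ g i (R i) * R i \<le> R (Suc i)" "\<forall>i. R (Suc i) \<le> 8 * 4 ^ g i (R i) * R i"
    by (rule adaptive_gcf[of g])
  note R0 = R[rule_format] and app = app[rule_format] and gr = gr[rule_format]
  have pos: "0 < real_of_int (R i)" for i using R0 by simp
  have gap0: "0 < P i - R i * \<tau>" for i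
    using app(1)[of i] pos[of "Suc i"] by (smt (verit) divide_pos_pos)
  have grow: "6 * R i ^ i \<le> R (Suc i)" for i
  proof -
    have "int (nat (R i)) < 2 ^ nat (R i)" by (rule of_nat_less_two_power)
    also have "(2::int) ^ nat (R i) \<le> 4 ^ nat (R i)" by (intro power_mono) auto
    finally have "R i \<le> 4 ^ nat (R i)" using R0[of i] by simp
    then have "R i ^ i \<le> (4 ^ nat (R i)) ^ i" using R0[of i] by (intro power_mono) auto
    also have "\<dots> = 4 ^ g i (R i) * 1" by (simp add: g_def power_mult)
    also have "\<dots> \<le> 4 ^ g i (R i) * R i" using R0[of i] by (intro mult_left_mono) auto
    finally show ?thesis using gr(1)[of i] by linarith
  qed
  have "\<not> irrationality_exponent \<tau> \<mu>" for \<mu>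
  proof (rule not_irrationality_exponentI[of R P \<tau> 1 "\<mu> + 1", OF Rlim])
    show "P i \<noteq> R i * \<tau>" for i using gap0[of i] by simp
    have "\<bar>P i - R i * \<tau>\<bar> \<le> 1 / R i powr (\<mu> + 1 - 1)" if "nat \<lceil>\<mu>\<rceil> \<le> i" for i
    proof -
      have "R i powr \<mu> \<le> R i powr i"
        using that R0[of i] by (intro powr_mono) linarith+
      also have "\<dots> = real_of_int (R i) ^ i" using pos[of i] by (rule powr_realpow)
      finally have "6 * R i powr \<mu> \<le> R (Suc i)"
        using grow[of i, folded of_int_le_iff[where 'a = real]] by simp
      then have "6 / R (Suc i) \<le> 6 / (6 * R i powr \<mu>)"
        using pos[of i] pos[of "Suc i"] by (intro divide_left_mono) auto
      then show ?thesis using app(2)[of i] gap0[of i] by simp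
    qed
    then show "\<forall>\<^sub>F i in sequentially. \<bar>P i - R i * \<tau>\<bar> \<le> 1 / R i powr (\<mu> + 1 - 1)"
      by (rule eventually_sequentiallyI)
  qed simp
  then have "\<mu>\<^sub>I \<tau> = \<infinity>"
    by (simp add: asymptotic_irrationality_exponent_def top_ereal_def)
  then show ?thesis using a by blast
qed

theorem theorem3p4:
  fixes s :: ereal
  assumes "s \<in> {1} \<union> {2..\<infinity>}"
  shows "\<exists>(a :: nat \<Rightarrow> real) (\<tau> :: real).
           (\<forall>n\<ge>1. a n \<in> {1, 2}) \<and> gcf_has_value a \<tau> \<and> \<mu>\<^sub>I \<tau> = s"
proof (cases s)
  case (real r)
  with assms consider "r = 1" | "2 \<le> r" by auto
  then show ?thesis
  proof cases
    case 1
    have "s = 1" unfolding real 1 one_ereal_def ..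
    then show ?thesis using gcf_of_twos asymptotic_irrationality_exponent_1
      by (intro exI[of _ "\<lambda>_. 2"] exI[of _ 1]) auto
  next
    case 2
    then show ?thesis using gcf_with_finite_exponent real by simp
  qed
next
  case PInf
  then show ?thesis using gcf_with_infinite_exponent by simp
next
  case MInf
  with assms show ?thesis by auto
qed

end
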